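(* Consider a mapping $F:\mathbb{R}^n\times\mathbb{R}^m\rightrightarrows\mathbb{R}^m$ and a point $(\bar x,\bar y)$ with $0\in F(\bar x,\bar y)$. Assume that $F$ has the SCD property around $(\bar x,\bar y,0)$ and $\mathrm{scd\,reg}\,F(\bar x,\bar y,0)<\infty$. Further suppose that there exists a neighborhood $\Omega$ of $\bar x$ and a continuous function $\sigma:\Omega\to\mathbb{R}^m$ with $\sigma(\bar x)=\bar y$ and $0\in F(x,\sigma(x))$, $x\in\Omega$. Then there exists an open neighborhood $U\subset\Omega$ of $\bar x$ such that for every $x\in U$ there holds $\mathrm{scd\,reg}\,F(x,\sigma(x),0)<\infty$ and $\sigma$ is semismooth at $x$ with respect to the mapping $\Psi:\mathbb{R}^n\rightrightarrows\mathbb{R}^{m\times n}$ given by $$\Psi(x):=\{-X_{L^*}^T : L^*\in\mathcal{S}^*F(x,\sigma(x),0)\},\quad x\in\mathrm{dom}\,\Psi:=U,$$ provided $F$ is SCD semismooth$^*$ at $(x,\sigma(x),0)$.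
   Context: For a multifunction $G:\mathbb{R}^p\rightrightarrows\mathbb{R}^q$, $\mathrm{gph}\,G=\{(x,y) : y\in G(x)\}$. $\mathcal{Z}_{p,q}$ is the metric space of all $p$-dimensional subspaces of $\mathbb{R}^{p+q}=\mathbb{R}^p\times\mathbb{R}^q$ with metric $d(L_1,L_2)=\|P_1-P_2\|$, $P_i$ the orthogonal projection matrix onto $L_i$. Tangent cone: $T_C(z)=\{w : \exists t_k\downarrow0,\ w_k\to w,\ z+t_kw_k\in C\}$. $\mathcal{O}_G$ is the set of $(x,y)\in\mathrm{gph}\,G$ with $T_{\mathrm{gph}\,G}(x,y)\in\mathcal{Z}_{p,q}$, and $\mathcal{S}G(x,y)=\{L\in\mathcal{Z}_{p,q} : \exists(x_k,y_k)\in\mathcal{O}_G,\ (x_k,y_k)\to(x,y),\ d(L,T_{\mathrm{gph}\,G}(x_k,y_k))\to0\}$. For $L\in\mathcal{Z}_{p,q}$, $L^*=\{(-v^*,u^* )\in\mathbb{R}^q\times\mathbb{R}^p : (u^*,v^* )\in L^\perp\}\in\mathcal{Z}_{q,p}$; $\mathcal{S}^*G(x,y)=\{L^* : L\in\mathcal{S}G(x,y)\}$; $(\bigcup\mathcal{S}^*G)(x,y)=\bigcup_{L^*\in\mathcal{S}^*G(x,y)}L^*$. $G$ has the SCD property at $(x,y)\in\mathrm{gph}\,G$ if $\mathcal{S}^*G(x,y)\ne\emptyset$, and around $(x,y)$ if it has it at all points of $\mathrm{gph}\,G$ sufficiently close to $(x,y)$. $G$ is SCD semismooth$^*$ (SCD-ss$^*$)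 at $(\bar x,\bar y)\in\mathrm{gph}\,G$ if $G$ has the SCD property around $(\bar x,\bar y)$ and for every $\epsilon>0$ there is $\delta>0$ with $|\langle x^*,x-\bar x\rangle-\langle y^*,y-\bar y\rangle|\le\epsilon\|(x,y)-(\bar x,\bar y)\|\,\|(y^*,x^* )\|$ for all $(x,y)\in\mathrm{gph}\,G$ with $\|(x,y)-(\bar x,\bar y)\|\le\delta$ and all $(y^*,x^* )\in(\bigcup\mathcal{S}^*G)(x,y)$. These are applied to $F:\mathbb{R}^n\times\mathbb{R}^m\rightrightarrows\mathbb{R}^m$ viewed as a multifunction from $\mathbb{R}^{n+m}$ to $\mathbb{R}^m$, so $\mathcal{S}^*F(x,y,z)\subset\mathcal{Z}_{m,n+m}$, and elements of $L^*\in\mathcal{S}^*F(x,y,z)$ are written $(z^*,x^*,y^* )\in\mathbb{R}^m\times\mathbb{R}^n\times\mathbb{R}^m$. Define $\mathrm{scd\,reg}\,F(x,y,z):=\sup\{\|(z^*,x^* )\| : (z^*,x^*,y^* )\in(\bigcup\mathcal{S}^*F)(x,y,z),\ \|y^*\|\le1\}$. If $L^*\in\mathcal{Z}_{m,n+m}$ satisfies $(z^*,x^*,0)\in L^*\Rightarrow z^*=0,x^*=0$ (which is the case for all $L^*\in\mathcal{S}^*F(x,y,z)$ when $\mathrm{scd\,reg}\,F(x,y,z)<\infty$), there are unique matrices $Z_{L^*}\in\mathbb{R}^{m\times m}$, $X_{L^*}\in\mathbb{R}^{n\times m}$ with $L^*=\{(Z_{L^*}p,X_{L^*}p,p) : p\in\mathbb{R}^m\}$.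 A mapping $\sigma$ from a set $\Omega\subset\mathbb{R}^n$ to $\mathbb{R}^m$ is semismooth with respect to $\Psi:\mathbb{R}^n\rightrightarrows\mathbb{R}^{m\times n}$ at $x$ (interior to $\Omega$) if $\mathrm{dom}\,\Psi=\{u : \Psi(u)\neq\emptyset\}$ is a neighborhood of $x$, $\Psi$ is locally bounded at $x$ (its values are uniformly bounded on a neighborhood of $x$), and $\lim_{x'\to x,\,x'\in\Omega,\,x'\neq x}\sup\{\|\sigma(x')-\sigma(x)-A(x'-x)\| : A\in\Psi(x')\}/\|x'-x\|=0$. *)

theory Defs
  imports "HOL-Analysis.Analysis"
begin

text \<open>
  A multifunction is a set-valued function. Its domain space \<open>'a\<close> and target space \<open>'b\<close> are
  arbitrary Euclidean spaces, of dimension \<open>p = DIM('a)\<close> and \<open>q = DIM('b)\<close>; product types carry the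
  Euclidean norm and inner product. Base points are pairs \<open>(x, y)\<close>.
\<close>

definition gph :: "('a \<Rightarrow> 'b set) \<Rightarrow> ('a \<times> 'b) set" where
  "gph G = {(x, y). y \<in> G x}"

definition mdom :: "('a \<Rightarrow> 'b set) \<Rightarrow> 'a set" where
  "mdom G = {x. G x \<noteq> {}}"

text \<open>As usual, \<open>t\<^sub>k \<down> 0\<close> means that the \<open>t\<^sub>k\<close> are positive and tend to 0.\<close>

definition tangent_cone :: "'a::real_normed_vector set \<Rightarrow> 'a \<Rightarrow> 'a set" where
  "tangent_cone C z =
     {w. \<exists>(t :: nat \<Rightarrow> real) (ws :: nat \<Rightarrow> 'a).
           (\<forall>k. t k > 0) \<and> t \<longlonglongrightarrow> 0 \<and> ws \<longlonglongrightarrow> w \<and> (\<forall>k. z + t k *\<^sub>R ws k \<in> C)}"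

definition Zsp :: "('a::euclidean_space \<times> 'b::euclidean_space) set set" where
  "Zsp = {L. subspace L \<and> dim L = DIM('a)}"

definition orth_proj :: "'a::euclidean_space set \<Rightarrow> 'a \<Rightarrow> 'a" where
  "orth_proj L z = (THE u. u \<in> L \<and> z - u \<in> orthogonal_comp L)"

definition Zdist :: "'a::euclidean_space set \<Rightarrow> 'a set \<Rightarrow> real" where
  "Zdist L1 L2 = onorm (\<lambda>z. orth_proj L1 z - orth_proj L2 z)"

definition O_set :: "('a::euclidean_space \<Rightarrow> 'b::euclidean_space set) \<Rightarrow> ('a \<times> 'b) set" where
  "O_set G = {z \<in> gph G. tangent_cone (gph G) z \<in> Zsp}"

definition S_der ::
  "('a::euclidean_space \<Rightarrow> 'b::euclidean_space set) \<Rightarrow> 'a \<times> 'b \<Rightarrow> ('a \<times> 'b) set set" where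
  "S_der G z =
     {L \<in> Zsp. \<exists>zs :: nat \<Rightarrow> 'a \<times> 'b.
        (\<forall>k. zs k \<in> O_set G) \<and> zs \<longlonglongrightarrow> z \<and>
        (\<lambda>k. Zdist L (tangent_cone (gph G) (zs k))) \<longlonglongrightarrow> 0}"

definition dual_sub :: "('a::euclidean_space \<times> 'b::euclidean_space) set \<Rightarrow> ('b \<times> 'a) set" where
  "dual_sub L = {(- v, u) | u v. (u, v) \<in> orthogonal_comp L}"

definition S_star ::
  "('a::euclidean_space \<Rightarrow> 'b::euclidean_space set) \<Rightarrow> 'a \<times> 'b \<Rightarrow> ('b \<times> 'a) set set" where
  "S_star G z = dual_sub ` S_der G z"

definition scd_at ::
  "('a::euclidean_space \<Rightarrow> 'b::euclidean_space set) \<Rightarrow> 'a \<times> 'b \<Rightarrow> bool" where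
  "scd_at G z \<longleftrightarrow> z \<in> gph G \<and> S_star G z \<noteq> {}"

definition scd_around ::
  "('a::euclidean_space \<Rightarrow> 'b::euclidean_space set) \<Rightarrow> 'a \<times> 'b \<Rightarrow> bool" where
  "scd_around G z \<longleftrightarrow>
     z \<in> gph G \<and> (\<exists>\<delta>>0. \<forall>w \<in> gph G. dist w z \<le> \<delta> \<longrightarrow> scd_at G w)"

definition scd_semismooth_star ::
  "('a::euclidean_space \<Rightarrow> 'b::euclidean_space set) \<Rightarrow> 'a \<times> 'b \<Rightarrow> bool" where
  "scd_semismooth_star G zbar \<longleftrightarrow>
     zbar \<in> gph G \<and> scd_around G zbar \<and>
     (\<forall>\<epsilon>>0. \<exists>\<delta>>0. \<forall>x y. (x, y) \<in> gph G \<and> norm ((x, y) - zbar) \<le> \<delta> \<longrightarrow>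
        (\<forall>(ys, xs) \<in> \<Union> (S_star G (x, y)).
           \<bar>xs \<bullet> (x - fst zbar) - ys \<bullet> (y - snd zbar)\<bar>
             \<le> \<epsilon> * norm ((x, y) - zbar) * norm (ys, xs)))"

text \<open>
  From here on \<open>F\<close> maps \<open>\<real>\<^sup>n \<times> \<real>\<^sup>m\<close> to subsets of \<open>\<real>\<^sup>m\<close>, so the elements of a dual subspace
  are the triples \<open>(z\<^sup>*, x\<^sup>*, y\<^sup>*)\<close>. The supremum is taken in the extended reals.
\<close>

definition scd_reg ::
  "((real^'n) \<times> (real^'m) \<Rightarrow> (real^'m) set) \<Rightarrow> real^'n \<Rightarrow> real^'m \<Rightarrow> real^'m \<Rightarrow> ereal" where
  "scd_reg F x y z =
     Sup {ereal (norm (zs, xs)) | zs xs ys.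
            (zs, xs, ys) \<in> \<Union> (S_star F ((x, y), z)) \<and> norm ys \<le> 1}"

text \<open>
  The pair \<open>(Z, X)\<close> of matrices representing a dual subspace; it is meaningful only for subspaces in
  which \<open>(z\<^sup>*, x\<^sup>*, 0)\<close> forces \<open>z\<^sup>* = 0\<close> and \<open>x\<^sup>* = 0\<close>. The type
  \<open>real^'m^'n\<close> consists of the \<open>n \<times> m\<close> matrices.
\<close>

definition ZX_mat ::
  "((real^'m) \<times> (real^'n) \<times> (real^'m)) set \<Rightarrow> (real^'m^'m) \<times> (real^'m^'n)" where
  "ZX_mat L = (THE (Z, X). L = {(Z *v p, X *v p, p) | p. True})"

definition X_mat :: "((real^'m) \<times> (real^'n) \<times> (real^'m)) set \<Rightarrow> real^'m^'n" where
  "X_mat L = snd (ZX_mat L)"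

definition Psi ::
  "((real^'n) \<times> (real^'m) \<Rightarrow> (real^'m) set) \<Rightarrow> (real^'n \<Rightarrow> real^'m) \<Rightarrow> (real^'n) set
     \<Rightarrow> real^'n \<Rightarrow> (real^'n^'m) set" where
  "Psi F \<sigma> U x =
     (if x \<in> U then {- transpose (X_mat L) | L. L \<in> S_star F ((x, \<sigma> x), 0)} else {})"

text \<open>
  The supremum and the quotient are formed in the extended reals, so that an unbounded set of
  values gives \<open>\<infinity>\<close>.
\<close>

definition semismooth_wrt ::
  "(real^'n) set \<Rightarrow> (real^'n \<Rightarrow> real^'m) \<Rightarrow> (real^'n \<Rightarrow> (real^'n^'m) set) \<Rightarrow> real^'n \<Rightarrow> bool" where
  "semismooth_wrt \<Omega> \<sigma> \<Psi> x \<longleftrightarrow>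
     x \<in> interior \<Omega> \<and>
     x \<in> interior (mdom \<Psi>) \<and>
     (\<exists>V. open V \<and> x \<in> V \<and> bounded (\<Union>u\<in>V. \<Psi> u)) \<and>
     ((\<lambda>x'. (SUP A\<in>\<Psi> x'. ereal (norm (\<sigma> x' - \<sigma> x - A *v (x' - x)))) / ereal (norm (x' - x)))
        \<longlongrightarrow> 0) (at x within \<Omega>)"

end

(*
  If scd reg F stays finite at the reference point, the dual elements (zs, xs, ys) satisfy a bound
  norm (zs, xs) <= K * norm ys uniformly near that point: otherwise normalized violating elements
  would converge, by compactness of the space of subspaces and outer semicontinuity of S_star, to a
  unit vector (zs, xs, 0) in some dual subspace, whose multiples make scd reg infinite.
  Writing A = - transpose X and r = \<sigma> x' - \<sigma> x - A (x' - x), the SCD semismoothness inequality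
  applied to the dual element (Z r, X r, r) at (x', \<sigma> x', 0) has left-hand side norm r ^ 2, and the
  bound K turns it into norm r = o(norm (x' - x)).
*)

theory Submission
  imports Defs
begin

subsection \<open>The metric space of subspaces\<close>

text \<open>Two candidates differ by a vector lying both in \<open>L\<close> and in its orthogonal
  complement, hence orthogonal to itself. This discharges the uniqueness behind the definite
  description.\<close>

lemma orth_proj_eqI:
  assumes "subspace L" "u \<in> L" "z - u \<in> orthogonal_comp L"
  shows "orth_proj L z = u"
  unfolding orth_proj_def
proof (rule the_equality)
  fix v assume v: "v \<in> L \<and> z - v \<in> orthogonal_comp L"
  have "u - v \<in> L" using v assms by (intro subspace_diff) simp_all
  moreover have "(z - v) - (z - u) \<in> orthogonal_comp L"
    using v assms(3) by (metis subspace_diff subspace_orthogonal_comp)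
  ultimately have "orthogonal (u - v) ((z - v) - (z - u))"
    unfolding orthogonal_comp_def by blast
  then show "v = u" by (simp add: orthogonal_self)
qed (rule conjI[OF assms(2,3)])

lemma orth_proj_split:
  assumes "subspace L"
  shows "orth_proj L z \<in> L" "z - orth_proj L z \<in> orthogonal_comp L"
proof -
  obtain u v where u: "u \<in> span L" and v: "\<And>w. w \<in> span L \<Longrightarrow> orthogonal v w" and z: "z = u + v"
    using orthogonal_subspace_decomp_exists[of L z] by metis
  have "u \<in> L" using u assms by (simp add: span_eq_iff[THEN iffD2])
  moreover have "z - u \<in> orthogonal_comp L"
    using v z by (auto simp: orthogonal_comp_def orthogonal_commute span_base)
  ultimately show "orth_proj L z \<in> L" "z - orth_proj L z \<in> orthogonal_comp L"
    using orth_proj_eqI[OF assms] by auto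
qed

lemma orth_proj_eq_self_iff: "subspace L \<Longrightarrow> orth_proj L z = z \<longleftrightarrow> z \<in> L"
  using orth_proj_split(1)[of L z] orth_proj_eqI[of L z z] subspace_0[OF subspace_orthogonal_comp, of L]
  by auto

lemma orth_proj_eq_0_iff: "subspace L \<Longrightarrow> orth_proj L z = 0 \<longleftrightarrow> z \<in> orthogonal_comp L"
  using orth_proj_split(2)[of L z] orth_proj_eqI[of L 0 z] subspace_0[of L] by auto

lemma linear_orth_proj:
  assumes "subspace L"
  shows "linear (orth_proj L)"
proof (rule linearI)
  fix x y and c :: real
  note s = orth_proj_split[OF assms]
  show "orth_proj L (x + y) = orth_proj L x + orth_proj L y"
    using subspace_add[OF subspace_orthogonal_comp s(2)[of x] s(2)[of y]]
    by (intro orth_proj_eqI) (auto simp: assms s subspace_add algebra_simps)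
  show "orth_proj L (c *\<^sub>R x) = c *\<^sub>R orth_proj L x"
    using subspace_scale[OF subspace_orthogonal_comp s(2)[of x], of c]
    by (intro orth_proj_eqI) (auto simp: assms s subspace_scale algebra_simps)
qed

text \<open>The remainder of \<open>y\<close> is orthogonal to \<open>L\<close>. The identity
  encodes self-adjointness and idempotence at once and survives pointwise limits.\<close>

lemma inner_orth_proj:
  assumes "subspace L"
  shows "orth_proj L x \<bullet> y = orth_proj L x \<bullet> orth_proj L y"
  using orth_proj_split(1)[OF assms, of x] orth_proj_split(2)[OF assms, of y]
  by (auto simp: orthogonal_comp_def orthogonal_def inner_diff_right)

lemma norm_orth_proj_le:
  assumes "subspace L"
  shows "norm (orth_proj L x) \<le> norm x"
proof -
  have "norm (orth_proj L x) * norm (orth_proj L x) = orth_proj L x \<bullet> x"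
    using inner_orth_proj[OF assms, of x x] by (simp add: norm_eq_sqrt_inner)
  also have "\<dots> \<le> norm (orth_proj L x) * norm x" by (rule norm_cauchy_schwarz)
  finally show ?thesis
    by (cases "orth_proj L x = 0") auto
qed

text \<open>Placing projections in the normed space of bounded operators turns \<open>Zdist\<close>
  into an ordinary \<open>dist\<close> and makes the Heine-Borel property available. The value is
  meaningful for subspaces only.\<close>

definition proj_blinfun :: "'a::euclidean_space set \<Rightarrow> 'a \<Rightarrow>\<^sub>L 'a" where
  "proj_blinfun L = Blinfun (orth_proj L)"

lemma proj_blinfun_apply:
  "subspace L \<Longrightarrow> blinfun_apply (proj_blinfun L) = orth_proj L"
  by (simp add: proj_blinfun_def bounded_linear_Blinfun_apply linear_orth_proj linear_linear)

lemma norm_proj_blinfun_le: "subspace L \<Longrightarrow> norm (proj_blinfun L) \<le> 1"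
  by (rule norm_blinfun_bound) (auto simp: proj_blinfun_apply norm_orth_proj_le)

lemma Zdist_eq_dist:
  assumes "subspace L1" "subspace L2"
  shows "Zdist L1 L2 = dist (proj_blinfun L1) (proj_blinfun L2)"
  by (simp add: Zdist_def dist_norm norm_blinfun.rep_eq minus_blinfun.rep_eq
      proj_blinfun_apply assms)

text \<open>The projection onto \<open>M\<close> is injective on \<open>L\<close>: a vector
  \<open>x\<close> of \<open>L\<close> that it kills equals the difference of the two projections
  applied to \<open>x\<close>, and this difference has operator norm below 1.\<close>

lemma dim_le_of_proj_close:
  assumes "subspace L" "subspace M" "dist (proj_blinfun L) (proj_blinfun M) < 1"
  shows "dim L \<le> dim M"
proof -
  have inj: "x = 0" if "x \<in> L" "orth_proj M x = 0" for x
  proof (rule ccontr)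
    assume "x \<noteq> 0"
    have "x = blinfun_apply (proj_blinfun L - proj_blinfun M) x"
      using that assms orth_proj_eq_self_iff[of L x] by (simp add: blinfun.diff_left proj_blinfun_apply)
    then have "norm x \<le> norm (proj_blinfun L - proj_blinfun M) * norm x"
      by (metis norm_blinfun)
    also have "\<dots> < 1 * norm x"
      using assms(3) \<open>x \<noteq> 0\<close> by (intro mult_strict_right_mono) (auto simp: dist_norm)
    finally show False by simp
  qed
  have "inj_on (orth_proj M) L"
    using inj linear_inj_on_iff_eq_0[OF linear_orth_proj[OF assms(2)] assms(1)] by auto
  then have "dim L = dim (orth_proj M ` L)"
    using dim_image_eq[OF linear_orth_proj[OF assms(2)]] assms(1) by (metis span_eq_iff)
  also have "\<dots> \<le> dim M"
    using orth_proj_split(1)[OF assms(2)] by (intro dim_subset) auto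
  finally show ?thesis .
qed

text \<open>The orthogonal projections are the idempotent self-adjoint operators, so they form a closed
  set.\<close>

lemma proj_blinfun_limit:
  fixes P :: "'a::euclidean_space \<Rightarrow>\<^sub>L 'a"
  assumes L: "\<And>k. subspace (L k)" and lim: "(\<lambda>k. proj_blinfun (L k)) \<longlonglongrightarrow> P"
  obtains M where "subspace M" "P = proj_blinfun M"
proof -
  let ?P = "blinfun_apply P"
  have ptw: "(\<lambda>k. orth_proj (L k) x) \<longlonglongrightarrow> ?P x" for x
    using blinfun.tendsto[OF lim tendsto_const, of x] by (simp add: proj_blinfun_apply L)
  have inner: "?P x \<bullet> y = ?P x \<bullet> ?P y" for x y
  proof (rule LIMSEQ_unique)
    show "(\<lambda>k. orth_proj (L k) x \<bullet> y) \<longlonglongrightarrow> ?P x \<bullet> y" by (intro tendsto_intros ptw)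
    show "(\<lambda>k. orth_proj (L k) x \<bullet> y) \<longlonglongrightarrow> ?P x \<bullet> ?P y"
      by (subst inner_orth_proj[OF L]) (intro tendsto_intros ptw)
  qed
  have sub: "subspace (range ?P)"
    by (intro linear_subspace_image bounded_linear.linear blinfun.bounded_linear_right subspace_UNIV)
  \<comment> \<open>The only candidate subspace is the range of the limit; \<open>inner\<close> says
    that \<open>y - ?P y\<close> is orthogonal to it.\<close>
  have "orth_proj (range ?P) y = ?P y" for y
    by (rule orth_proj_eqI[OF sub])
       (auto simp: orthogonal_comp_def orthogonal_def inner_diff_right inner[symmetric])
  then have "P = proj_blinfun (range ?P)"
    by (intro blinfun_eqI) (simp add: proj_blinfun_apply sub)
  with sub show ?thesis using that by blast
qed

text \<open>Projections lie in the unit ball of a finite-dimensional operator space, so a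
  subsequence converges, and its limit is again a projection. The dimension is kept because
  subspaces at distance below 1 have equal dimension.\<close>

lemma Zsp_sequentially_compact:
  fixes L :: "nat \<Rightarrow> ('a::euclidean_space \<times> 'b::euclidean_space) set"
  assumes "\<And>k. L k \<in> Zsp"
  obtains M r where "M \<in> Zsp" "strict_mono (r :: nat \<Rightarrow> nat)" "(\<lambda>k. Zdist M (L (r k))) \<longlonglongrightarrow> 0"
proof -
  have sub: "subspace (L k)" and dim: "dim (L k) = DIM('a)" for k
    using assms[of k] by (auto simp: Zsp_def)
  have "bounded (range (\<lambda>k. proj_blinfun (L k)))"
    using norm_proj_blinfun_le[OF sub] by (auto simp: bounded_iff)
  then obtain r P where r: "strict_mono (r :: nat \<Rightarrow> nat)"
    and lim: "(\<lambda>k. proj_blinfun (L (r k))) \<longlonglongrightarrow> P"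
    using bounded_imp_convergent_subsequence[of "\<lambda>k. proj_blinfun (L k)"] by (auto simp: o_def)
  from proj_blinfun_limit[of "\<lambda>k. L (r k)", OF sub lim]
  obtain M where M: "subspace M" "P = proj_blinfun M" .
  have d: "(\<lambda>k. dist (proj_blinfun M) (proj_blinfun (L (r k)))) \<longlonglongrightarrow> 0"
    using tendsto_dist_iff[THEN iffD1, OF lim] M(2) by (simp add: dist_commute)
  then have "\<forall>\<^sub>F k in sequentially. dist (proj_blinfun M) (proj_blinfun (L (r k))) < 1"
    by (rule order_tendstoD) simp
  then obtain k where k: "dist (proj_blinfun M) (proj_blinfun (L (r k))) < 1"
    by (auto simp: eventually_sequentially)
  then have "dim M = dim (L (r k))"
    using dim_le_of_proj_close sub M(1) by (metis dist_commute order_antisym)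
  then have "M \<in> Zsp" using M(1) dim by (simp add: Zsp_def)
  with r d show ?thesis
    using that by (simp add: Zdist_eq_dist sub M(1))
qed

text \<open>Membership in the complement is the equation \<open>orth_proj L u = 0\<close>, and
  operator evaluation is jointly continuous.\<close>

lemma orthogonal_comp_limit:
  assumes sub: "subspace M" "\<And>k. subspace (L k)" and d: "(\<lambda>k. Zdist M (L k)) \<longlonglongrightarrow> 0"
    and u: "\<And>k. u k \<in> orthogonal_comp (L k)" "u \<longlonglongrightarrow> v"
  shows "v \<in> orthogonal_comp M"
proof -
  have "(\<lambda>k. proj_blinfun (L k)) \<longlonglongrightarrow> proj_blinfun M"
    using d by (subst tendsto_dist_iff) (simp add: Zdist_eq_dist sub dist_commute)
  from blinfun.tendsto[OF this u(2)] have "(\<lambda>k. orth_proj (L k) (u k)) \<longlonglongrightarrow> orth_proj M v"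
    by (simp add: proj_blinfun_apply sub)
  moreover have "orth_proj (L k) (u k) = 0" for k
    using u(1) by (simp add: orth_proj_eq_0_iff sub)
  ultimately have "orth_proj M v = 0" by (simp add: LIMSEQ_const_iff)
  then show ?thesis by (simp add: orth_proj_eq_0_iff sub)
qed

subsection \<open>Outer semicontinuity of the SCD derivative\<close>

lemma S_der_approx:
  assumes "L \<in> S_der G w" "e > 0"
  obtains v where "v \<in> O_set G" "dist v w < e" "Zdist L (tangent_cone (gph G) v) < e"
proof -
  obtain zs where zs: "\<And>k. zs k \<in> O_set G" "zs \<longlonglongrightarrow> w"
    "(\<lambda>k. Zdist L (tangent_cone (gph G) (zs k))) \<longlonglongrightarrow> 0"
    using assms(1) by (auto simp: S_der_def)
  have "\<forall>\<^sub>F k in sequentially. dist (zs k) w < e \<and> Zdist L (tangent_cone (gph G) (zs k)) < e"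
    using tendstoD[OF zs(2) assms(2)] order_tendstoD(2)[OF zs(3) assms(2)]
    by (rule eventually_conj)
  then obtain k where "dist (zs k) w < e" "Zdist L (tangent_cone (gph G) (zs k)) < e"
    by (auto simp: eventually_sequentially)
  with zs(1) that show ?thesis by blast
qed

text \<open>A diagonal argument: each \<open>L k\<close> is replaced by a tangent space at a point
  of \<open>O_set G\<close>, with both errors below \<open>1 / (k + 1)\<close>, and the triangle
  inequality does the rest.\<close>

lemma S_der_closed:
  assumes L: "\<And>k. L k \<in> S_der G (w k)" and w: "w \<longlonglongrightarrow> z"
    and M: "M \<in> Zsp" and d: "(\<lambda>k. Zdist M (L k)) \<longlonglongrightarrow> 0"
  shows "M \<in> S_der G z"
proof -
  have "\<exists>v. v \<in> O_set G \<and> dist v (w k) < inverse (real (Suc k)) \<and>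
          Zdist (L k) (tangent_cone (gph G) v) < inverse (real (Suc k))" for k
    using S_der_approx[OF L, of "inverse (real (Suc k))" k] by (metis inverse_positive_iff_positive of_nat_0_less_iff zero_less_Suc)
  then obtain v where v: "\<And>k. v k \<in> O_set G" "\<And>k. dist (v k) (w k) < inverse (real (Suc k))"
    "\<And>k. Zdist (L k) (tangent_cone (gph G) (v k)) < inverse (real (Suc k))"
    by metis
  let ?T = "\<lambda>k. tangent_cone (gph G) (v k)"
  have sub: "subspace M" "subspace (L k)" "subspace (?T k)" for k
    using M L[of k] v(1)[of k] by (auto simp: Zsp_def S_der_def O_set_def)
  have lim0: "(\<lambda>k. inverse (real (Suc k))) \<longlonglongrightarrow> 0" by (rule LIMSEQ_inverse_real_of_nat)
  have "(\<lambda>k. inverse (real (Suc k)) + dist (w k) z) \<longlonglongrightarrow> 0 + 0"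
    by (intro tendsto_add lim0 tendsto_dist_iff[THEN iffD1, OF w])
  moreover have "dist (v k) z \<le> inverse (real (Suc k)) + dist (w k) z" for k
    using dist_triangle[of "v k" z "w k"] v(2)[of k] by linarith
  ultimately have "(\<lambda>k. dist (v k) z) \<longlonglongrightarrow> 0"
    using real_tendsto_sandwich[OF _ _ tendsto_const,
        of 0 "\<lambda>k. dist (v k) z" sequentially "\<lambda>k. inverse (real (Suc k)) + dist (w k) z"]
    by (simp del: of_nat_Suc)
  then have vz: "v \<longlonglongrightarrow> z" by (rule tendsto_dist_iff[THEN iffD2])
  have "(\<lambda>k. Zdist M (L k) + inverse (real (Suc k))) \<longlonglongrightarrow> 0 + 0"
    by (intro tendsto_add d lim0)
  moreover have "Zdist M (?T k) \<le> Zdist M (L k) + inverse (real (Suc k))" for k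
    using dist_triangle[of "proj_blinfun M" "proj_blinfun (?T k)" "proj_blinfun (L k)"] v(3)[of k]
    by (simp add: Zdist_eq_dist sub)
  moreover have "0 \<le> Zdist M (?T k)" for k by (simp add: Zdist_eq_dist sub)
  ultimately have "(\<lambda>k. Zdist M (?T k)) \<longlonglongrightarrow> 0"
    using real_tendsto_sandwich[OF _ _ tendsto_const, of 0 "\<lambda>k. Zdist M (?T k)" sequentially
        "\<lambda>k. Zdist M (L k) + inverse (real (Suc k))"]
    by (simp del: of_nat_Suc)
  with M v(1) vz show ?thesis by (auto simp: S_der_def)
qed

text \<open>The subspaces containing the \<open>u k\<close> need not converge, but by compactness a
  subsequence of their primal counterparts does, and its limit yields a dual subspace containing
  \<open>v\<close>.\<close>

lemma S_star_limit:
  fixes G :: "'a::euclidean_space \<Rightarrow> 'b::euclidean_space set"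
  assumes u: "\<And>k. u k \<in> \<Union> (S_star G (w k))" and w: "w \<longlonglongrightarrow> z" and lim: "u \<longlonglongrightarrow> v"
  shows "v \<in> \<Union> (S_star G z)"
proof -
  have dual: "x \<in> dual_sub L \<longleftrightarrow> (snd x, - fst x) \<in> orthogonal_comp L"
    for x and L :: "('a \<times> 'b) set"
    by (cases x) (force simp: dual_sub_def)
  obtain L where L: "\<And>k. L k \<in> S_der G (w k)" "\<And>k. u k \<in> dual_sub (L k)"
    using u by (simp add: S_star_def) metis
  have Z: "L k \<in> Zsp" for k using L(1) by (auto simp: S_der_def)
  obtain M r where M: "M \<in> Zsp" and r: "strict_mono (r :: nat \<Rightarrow> nat)"
    and d: "(\<lambda>k. Zdist M (L (r k))) \<longlonglongrightarrow> 0"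
    by (rule Zsp_sequentially_compact[of L, OF Z])
  have "M \<in> S_der G z"
    using S_der_closed[of "\<lambda>k. L (r k)" G "\<lambda>k. w (r k)"] L(1) M d LIMSEQ_subseq_LIMSEQ[OF w r]
    by (simp add: o_def)
  moreover have "v \<in> dual_sub M"
    unfolding dual
  proof (rule orthogonal_comp_limit[OF _ _ d])
    show "(snd (u (r k)), - fst (u (r k))) \<in> orthogonal_comp (L (r k))" for k
      using L(2) dual by blast
    show "(\<lambda>k. (snd (u (r k)), - fst (u (r k)))) \<longlonglongrightarrow> (snd v, - fst v)"
      using LIMSEQ_subseq_LIMSEQ[OF lim r] unfolding o_def by (intro tendsto_intros)
    show "subspace M" "subspace (L (r k))" for k
      using M Z[of "r k"] by (simp_all add: Zsp_def)
  qed
  ultimately show ?thesis by (auto simp: S_star_def)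
qed

text \<open>The dual is the image of the complement, of dimension \<open>DIM('b)\<close>, under an
  injective linear map. The factors are swapped, so this is the dimension required by
  \<open>Zsp\<close> on the target type.\<close>

lemma dual_sub_in_Zsp:
  fixes L :: "('a::euclidean_space \<times> 'b::euclidean_space) set"
  assumes "L \<in> Zsp"
  shows "dual_sub L \<in> Zsp"
proof -
  let ?f = "\<lambda>x :: 'a \<times> 'b. (- snd x, fst x)"
  have eq: "dual_sub L = ?f ` orthogonal_comp L" by (force simp: dual_sub_def)
  have lin: "linear ?f" by (rule linearI) auto
  have "dim (dual_sub L) = dim (orthogonal_comp L)"
    unfolding eq by (rule dim_image_eq[OF lin]) (auto simp: inj_on_def)
  moreover have "dim (orthogonal_comp L) + dim L = DIM('a) + DIM('b)"
    using dim_subspace_orthogonal_to_vectors[of L UNIV] assms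
    by (simp add: Zsp_def orthogonal_comp_def)
  ultimately show ?thesis
    using assms by (simp add: Zsp_def eq linear_subspace_image[OF lin] subspace_orthogonal_comp)
qed

lemma S_star_in_Zsp: "L \<in> S_star G z \<Longrightarrow> L \<in> Zsp"
  by (auto simp: S_star_def S_der_def intro: dual_sub_in_Zsp)

subsection \<open>The SCD regularity modulus\<close>

text \<open>A nonzero element with last component 0 can be scaled at will without leaving the
  constraint \<open>norm ys \<le> 1\<close>, which would make the supremum infinite.\<close>

lemma scd_reg_finite_injective:
  assumes reg: "scd_reg F x y z < \<infinity>" and u: "(zs, xs, 0) \<in> \<Union> (S_star F ((x, y), z))"
  shows "zs = 0 \<and> xs = 0"
proof (rule ccontr)
  assume "\<not> (zs = 0 \<and> xs = 0)"
  then have n: "norm (zs, xs) > 0" by (auto simp: zero_prod_def)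
  obtain R :: nat where R: "scd_reg F x y z < ereal (real R)"
    using reg less_PInf_Ex_of_nat by (metis less_irrefl)
  obtain L where L: "L \<in> S_star F ((x, y), z)" "(zs, xs, 0) \<in> L" using u by blast
  \<comment> \<open>Scales the element to norm exactly \<open>R\<close>, a number strictly above the
    supremum.\<close>
  define c where "c = real R / norm (zs, xs)"
  have "subspace L" using S_star_in_Zsp[OF L(1)] by (simp add: Zsp_def)
  from subspace_scale[OF this L(2), of c]
  have "(c *\<^sub>R zs, c *\<^sub>R xs, 0) \<in> \<Union> (S_star F ((x, y), z))" using L(1) by auto
  then have "ereal (norm (c *\<^sub>R zs, c *\<^sub>R xs)) \<le> scd_reg F x y z"
    unfolding scd_reg_def by (intro Sup_upper) force
  moreover have "norm (c *\<^sub>R zs, c *\<^sub>R xs) = real R"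
    using n norm_scaleR[of c "(zs, xs)"] by (simp add: c_def)
  ultimately show False using R by simp
qed

text \<open>Stated homogeneously in \<open>ys\<close>, the bound covers all dual elements and gives
  injectivity at once by taking \<open>ys = 0\<close>.\<close>

lemma scd_reg_finite_uniform:
  fixes F :: "(real^'n) \<times> (real^'m) \<Rightarrow> (real^'m) set"
  assumes reg: "scd_reg F x y z < \<infinity>"
  obtains d K where "d > 0" "K \<ge> 0"
    "\<And>w zs xs ys. dist w ((x, y), z) < d \<Longrightarrow> (zs, xs, ys) \<in> \<Union> (S_star F w) \<Longrightarrow>
        norm (zs, xs) \<le> K * norm ys"
proof -
  have "\<exists>d>0. \<exists>K\<ge>0. \<forall>w zs xs ys. dist w ((x, y), z) < d \<longrightarrow> (zs, xs, ys) \<in> \<Union> (S_star F w) \<longrightarrow>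
        norm (zs, xs) \<le> K * norm ys"
  proof (rule ccontr)
    assume neg: "\<not> ?thesis"
    \<comment> \<open>The negation is used with radius \<open>1 / (k + 1)\<close> and constant
      \<open>k + 1\<close>, so the violations approach the reference point while the ratio blows
      up.\<close>
    have "\<exists>w zs xs ys. dist w ((x, y), z) < inverse (real (Suc k)) \<and> (zs, xs, ys) \<in> \<Union> (S_star F w) \<and>
        real (Suc k) * norm ys < norm (zs, xs)" for k
    proof -
      have "inverse (real (Suc k)) > 0" "real (Suc k) \<ge> 0" by simp_all
      with neg show ?thesis by (meson not_le)
    qed
    then obtain w zs xs ys where w: "\<And>k. dist (w k) ((x, y), z) < inverse (real (Suc k))"
      and u: "\<And>k. (zs k, xs k, ys k) \<in> \<Union> (S_star F (w k))"
      and big: "\<And>k. real (Suc k) * norm (ys k) < norm (zs k, xs k)" by metis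
    define u where "u k = (zs k, xs k, ys k)" for k
    define v where "v k = inverse (norm (u k)) *\<^sub>R u k" for k
    \<comment> \<open>Strictness of the violation excludes 0 and so permits normalization.\<close>
    have pos: "norm (zs k, xs k) > 0" for k
      using big[of k] by (meson le_less_trans mult_nonneg_nonneg norm_ge_zero of_nat_0_le_iff)
    then have u0: "u k \<noteq> 0" for k
      by (auto simp: u_def zero_prod_def)
    have v1: "norm (v k) = 1" for k using u0 by (simp add: v_def)
    have vS: "v k \<in> \<Union> (S_star F (w k))" for k
    proof -
      obtain L where "L \<in> S_star F (w k)" "u k \<in> L" using u[of k] by (auto simp: u_def)
      then show ?thesis
        using S_star_in_Zsp[of L F "w k"] by (auto simp: v_def Zsp_def intro: subspace_scale)
    qed
    \<comment> \<open>On the unit sphere the growing constant forces the last component to vanish in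
      the limit.\<close>
    have vy: "norm (snd (snd (v k))) \<le> inverse (real (Suc k))" for k
    proof -
      have "norm (zs k, xs k) \<le> norm (u k)" by (simp add: u_def norm_Pair)
      with big[of k] have "real (Suc k) * norm (ys k) \<le> norm (u k)" by linarith
      then have "norm (ys k) \<le> norm (u k) / real (Suc k)" by (simp add: field_simps)
      then have "norm (ys k) / norm (u k) \<le> inverse (real (Suc k))"
        using u0[of k] by (simp add: divide_simps mult.commute)
      then show ?thesis by (simp add: v_def u_def divide_inverse mult.commute)
    qed
    have lim0: "(\<lambda>k. inverse (real (Suc k))) \<longlonglongrightarrow> 0" by (rule LIMSEQ_inverse_real_of_nat)
    have wlim: "w \<longlonglongrightarrow> ((x, y), z)"
      by (rule metric_tendsto_imp_tendsto[OF lim0]) (simp add: w less_imp_le del: of_nat_Suc)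
    obtain r a where r: "strict_mono (r :: nat \<Rightarrow> nat)" and a: "(v \<circ> r) \<longlonglongrightarrow> a"
      using bounded_imp_convergent_subsequence[of v] v1 by (metis boundedI order_refl rangeE)
    have "a \<in> \<Union> (S_star F ((x, y), z))"
      by (rule S_star_limit[of "v \<circ> r" F "w \<circ> r"])
         (use vS a LIMSEQ_subseq_LIMSEQ[OF wlim r] in \<open>simp_all add: o_def\<close>)
    moreover have "snd (snd a) = 0"
    proof -
      have "(\<lambda>k. snd (snd (v (r k)))) \<longlonglongrightarrow> snd (snd a)"
        using a unfolding o_def by (intro tendsto_intros)
      moreover have "(\<lambda>k. snd (snd (v (r k)))) \<longlonglongrightarrow> 0"
      proof (rule metric_tendsto_imp_tendsto)
        show "(\<lambda>k. inverse (real (Suc (r k)))) \<longlonglongrightarrow> 0"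
          using LIMSEQ_subseq_LIMSEQ[OF lim0 r] by (simp add: o_def)
      qed (simp add: vy del: of_nat_Suc)
      ultimately show ?thesis by (rule LIMSEQ_unique)
    qed
    ultimately have "a = 0"
      using scd_reg_finite_injective[OF reg, of "fst a" "fst (snd a)"]
      by (cases a) (auto simp: zero_prod_def)
    moreover have "norm a = 1"
      using tendsto_norm[OF a] v1 by (simp add: o_def LIMSEQ_const_iff)
    ultimately show False by simp
  qed
  then show ?thesis using that by metis
qed

lemma scd_reg_le:
  assumes "K \<ge> 0"
    and "\<And>zs xs ys. (zs, xs, ys) \<in> \<Union> (S_star F ((x, y), z)) \<Longrightarrow> norm (zs, xs) \<le> K * norm ys"
  shows "scd_reg F x y z \<le> ereal K"
  unfolding scd_reg_def
proof (rule Sup_least, clarsimp)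
  fix zs xs ys L
  assume "(zs, xs, ys) \<in> L" "L \<in> S_star F ((x, y), z)" and ys: "norm ys \<le> 1"
  then have "norm (zs, xs) \<le> K * norm ys" using assms(2) by blast
  also have "\<dots> \<le> K * 1" using ys assms(1) by (rule mult_left_mono)
  finally show "norm (zs, xs) \<le> K" by simp
qed

subsection \<open>The matrix representation of dual subspaces\<close>

text \<open>The projection to the last component is injective on \<open>L\<close>, hence bijective
  by a dimension count. Its linear inverse supplies both matrices.\<close>

lemma ZX_mat_mem:
  fixes L :: "((real^'m) \<times> (real^'n) \<times> (real^'m)) set"
  assumes L: "L \<in> Zsp" and inj: "\<And>zs xs. (zs, xs, 0) \<in> L \<Longrightarrow> zs = 0 \<and> xs = 0"
  shows "(fst (ZX_mat L) *v p, X_mat L *v p, p) \<in> L"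
proof -
  let ?f = "\<lambda>u :: (real^'m) \<times> (real^'n) \<times> (real^'m). snd (snd u)"
  have sub: "subspace L" and dim: "dim L = DIM(real^'m)" using L by (auto simp: Zsp_def)
  have lin: "linear ?f" by (rule linearI) auto
  have injf: "inj_on ?f L"
    unfolding linear_inj_on_iff_eq_0[OF lin sub] using inj by (auto simp: zero_prod_def)
  have "dim (?f ` L) = dim L"
    using dim_image_eq[OF lin, of L] injf sub by (simp add: span_eq_iff[THEN iffD2])
  then have surj: "?f ` L = UNIV"
    using dim subspace_dim_equal[of "?f ` L" UNIV] linear_subspace_image[OF lin sub] by auto
  obtain g where gL: "range g \<subseteq> L" and g: "linear g" and gf: "\<And>u. u \<in> L \<Longrightarrow> g (?f u) = u"
    using linear_exists_left_inverse_on[OF lin sub injf] by metis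
  \<comment> \<open>Surjectivity upgrades the left inverse to a right inverse, so \<open>L\<close>
    is a graph over its last component.\<close>
  have fg: "?f (g p) = p" for p
  proof -
    have "p \<in> ?f ` L" unfolding surj by (rule UNIV_I)
    then obtain u where "p = ?f u" "u \<in> L" by (rule imageE)
    then show ?thesis using gf[of u] by simp
  qed
  define Z where "Z = matrix (\<lambda>p. fst (g p))"
  define X where "X = matrix (\<lambda>p. fst (snd (g p)))"
  have Z: "Z *v p = fst (g p)" for p
    unfolding Z_def by (subst matrix_vector_mul(2), rule linearI) (simp_all add: linear_add[OF g] linear_scale[OF g])
  have X: "X *v p = fst (snd (g p))" for p
    unfolding X_def by (subst matrix_vector_mul(2), rule linearI) (simp_all add: linear_add[OF g] linear_scale[OF g])
  have gp: "g p = (Z *v p, X *v p, p)" for p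
    using fg[of p] by (simp add: Z X prod_eq_iff)
  have "L \<subseteq> range g" using gf by (metis rangeI subsetI)
  with gL have "L = range g" by (rule subset_antisym[rotated])
  then have Leq: "L = {(Z *v p, X *v p, p) | p. True}" by (auto simp: gp)
  have "ZX_mat L = (Z, X)"
    unfolding ZX_mat_def
  proof (rule the_equality)
    show "case (Z, X) of (Z, X) \<Rightarrow> L = {(Z *v p, X *v p, p) | p. True}" using Leq by simp
    fix ZX' assume *: "case ZX' of (Z, X) \<Rightarrow> L = {(Z *v p, X *v p, p) | p. True}"
    obtain Z' X' where ZX': "ZX' = (Z', X')" by (cases ZX')
    \<comment> \<open>In a graph the last component determines the other two, so any second pair of
      matrices acts identically.\<close>
    have "Z' *v p = Z *v p \<and> X' *v p = X *v p" for p
    proof -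
      have "(Z' *v p, X' *v p, p) \<in> L" using * ZX' by auto
      then show ?thesis unfolding Leq by auto
    qed
    then show "ZX' = (Z, X)" by (simp add: ZX' matrix_eq)
  qed
  then show ?thesis using Leq by (auto simp: X_mat_def)
qed

text \<open>Pairing \<open>?q = transpose X *v h\<close> with itself moves \<open>X\<close> onto
  \<open>?q\<close>; one factor \<open>norm ?q\<close> then cancels.\<close>

lemma norm_transpose_mult_le:
  fixes X :: "real^'m^'n"
  assumes "\<And>p. norm (X *v p) \<le> K * norm p"
  shows "norm (transpose X *v h) \<le> K * norm h"
proof -
  let ?q = "transpose X *v h"
  have "norm ?q * norm ?q = h \<bullet> (X *v ?q)"
    by (simp add: dot_lmul_matrix[symmetric] power2_norm_eq_inner[symmetric] power2_eq_square)
  also have "\<dots> \<le> norm h * norm (X *v ?q)" by (rule norm_cauchy_schwarz)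
  also have "\<dots> \<le> norm h * (K * norm ?q)" by (intro mult_left_mono assms) simp
  finally have *: "norm ?q * norm ?q \<le> (K * norm h) * norm ?q" by (simp add: ac_simps)
  \<comment> \<open>Settles the case \<open>?q = 0\<close>, where nothing can be cancelled. The sign
    of \<open>K\<close> is read off from the assumption at a unit vector.\<close>
  have "0 \<le> K * norm h"
  proof (cases "h = 0")
    case False
    have "0 \<le> K * norm (axis undefined 1 :: real^'m)" using assms norm_ge_zero order_trans by blast
    then show ?thesis by simp
  qed simp
  with * show ?thesis by (cases "?q = 0") auto
qed

text \<open>The norm of the matrix type is the Euclidean norm of the entries, not the operator norm.
  The operator bound at the vectors \<open>axis j 1\<close> bounds every entry, and crude sums over
  the entries suffice.\<close>

lemma bounded_matrices:
  "bounded {A :: real^'n^'m. \<forall>h. norm (A *v h) \<le> K * norm h}"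
proof (rule boundedI)
  fix A :: "real^'n^'m" assume A: "A \<in> {A. \<forall>h. norm (A *v h) \<le> K * norm h}"
  have "\<bar>A $ i $ j\<bar> \<le> K" for i j
  proof -
    have "\<bar>A $ i $ j\<bar> = \<bar>(A *v axis j 1) $ i\<bar>"
      by (simp add: matrix_vector_mul_component inner_axis)
    also have "\<dots> \<le> norm (A *v axis j 1)" by (rule component_le_norm_cart)
    also have "\<dots> \<le> K" using A by (auto dest: spec[of _ "axis j 1"])
    finally show ?thesis .
  qed
  then have "norm (A $ i) \<le> of_nat CARD('n) * K" for i
    using norm_le_l1_cart[of "A $ i"] sum_bounded_above[of UNIV "\<lambda>j. \<bar>A $ i $ j\<bar>" K] by force
  then show "norm A \<le> of_nat CARD('m) * (of_nat CARD('n) * K)"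
    using L2_set_le_sum[of UNIV "\<lambda>i. norm (A $ i)"]
      sum_bounded_above[of UNIV "\<lambda>i. norm (A $ i)" "of_nat CARD('n) * K"]
    by (simp add: norm_vec_def)
qed

subsection \<open>Semismoothness of the implicit function\<close>

text \<open>The semismoothness inequality is tested with the dual element whose last component is the
  residual \<open>r\<close> itself.\<close>

lemma residual_estimate:
  fixes Z :: "real^'m^'m" and X :: "real^'m^'n" and h :: "real^'n" and s :: "real^'m"
  defines "r \<equiv> s - (- transpose X) *v h"
  assumes K: "K \<ge> 0" and ZX: "\<And>p. norm (Z *v p, X *v p) \<le> K * norm p"
    and e: "e \<ge> 0" "e * (1 + K) \<le> 1 / 2"
    and ineq: "\<bar>(X *v r, r) \<bullet> (h, s)\<bar> \<le> e * norm (h, s) * norm (Z *v r, X *v r, r)"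
  shows "norm r \<le> 2 * e * (1 + K)\<^sup>2 * norm h"
proof (cases "r = 0")
  case False
  have X: "norm (X *v p) \<le> K * norm p" for p
    using ZX[of p] norm_snd_le[of "X *v p" "Z *v p"] by linarith
  have r: "r = s + transpose X *v h"
    by (simp add: r_def matrix_vector_mult_def vec_eq_iff sum_negf)
  have "norm r * norm r = r \<bullet> (s + transpose X *v h)"
    unfolding r[symmetric] by (simp add: power2_norm_eq_inner[symmetric] power2_eq_square)
  \<comment> \<open>With \<open>r\<close> as last component, the dual pairing is exactly the squared
    norm of the residual.\<close>
  also have "\<dots> = (X *v r, r) \<bullet> (h, s)"
    using dot_lmul_matrix[of h X r]
    by (simp add: inner_add_right inner_commute[of r "h v* X"] inner_commute[of "X *v r" h])
  also have "\<dots> \<le> e * norm (h, s) * norm (Z *v r, X *v r, r)" using ineq by linarith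
  also have "\<dots> \<le> e * ((1 + K) * norm h + norm r) * ((1 + K) * norm r)"
  proof (intro mult_mono)
    \<comment> \<open>The increment \<open>s\<close> is not controlled by \<open>h\<close>
      beforehand; it is expressed through the residual, which is absorbed below.\<close>
    have "norm s \<le> norm r + norm (transpose X *v h)"
      using norm_triangle_ineq4[of r "transpose X *v h"] by (simp add: r)
    then have "norm s \<le> norm r + K * norm h"
      using norm_transpose_mult_le[OF X, of h] by linarith
    then show "norm (h, s) \<le> (1 + K) * norm h + norm r"
      using norm_Pair_le[of h s] by (simp add: algebra_simps)
    have "norm (Z *v r, X *v r, r) = norm ((Z *v r, X *v r), r)" by (simp add: norm_Pair)
    also have "\<dots> \<le> norm (Z *v r, X *v r) + norm r" by (rule norm_Pair_le)
    finally show "norm (Z *v r, X *v r, r) \<le> (1 + K) * norm r"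
      using ZX[of r] by (simp add: algebra_simps)
  qed (use K e in auto)
  finally have "norm r * norm r \<le> (e * ((1 + K) * norm h + norm r) * (1 + K)) * norm r"
    by (simp add: ac_simps)
  then have "norm r \<le> e * ((1 + K) * norm h + norm r) * (1 + K)" using False by simp
  also have "\<dots> = e * (1 + K)\<^sup>2 * norm h + e * (1 + K) * norm r"
    by (simp add: algebra_simps power2_eq_square)
  \<comment> \<open>Half of \<open>norm r\<close> moves to the left-hand side, whence the factor 2
    in the conclusion.\<close>
  also have "\<dots> \<le> e * (1 + K)\<^sup>2 * norm h + 1 / 2 * norm r"
    using e by (intro add_left_mono mult_right_mono) auto
  finally show ?thesis by simp
qed (use e in auto)

lemma semismooth_limitI:
  assumes "\<And>e. e > 0 \<Longrightarrow> \<forall>\<^sub>F x' in at x within \<Omega>. \<Psi> x' \<noteq> {} \<and>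
     (\<forall>A\<in>\<Psi> x'. norm (\<sigma> x' - \<sigma> x - A *v (x' - x)) \<le> e * norm (x' - x))"
  shows "((\<lambda>x'. (SUP A\<in>\<Psi> x'. ereal (norm (\<sigma> x' - \<sigma> x - A *v (x' - x)))) / ereal (norm (x' - x)))
           \<longlongrightarrow> 0) (at x within \<Omega>)" (is "(?f \<longlongrightarrow> 0) _")
proof (rule order_tendstoI)
  fix a :: ereal assume a: "a < 0"
  show "\<forall>\<^sub>F x' in at x within \<Omega>. a < ?f x'"
    using assms[of 1, OF zero_less_one]
  proof eventually_elim
    case (elim x')
    then obtain A where "A \<in> \<Psi> x'" by blast
    then have "0 \<le> (SUP A\<in>\<Psi> x'. ereal (norm (\<sigma> x' - \<sigma> x - A *v (x' - x))))"
      by (rule SUP_upper2) simp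
    then have "0 \<le> ?f x'" by simp
    with a show ?case by (rule less_le_trans)
  qed
next
  fix a :: ereal assume "0 < a"
  then obtain e where e: "0 < ereal e" "ereal e < a" using ereal_dense2 by blast
  \<comment> \<open>Ensures a positive denominator, so that the quotient simplifies to
    \<open>e\<close>.\<close>
  have "\<forall>\<^sub>F x' in at x within \<Omega>. x' \<noteq> x" by (simp add: eventually_at_filter)
  moreover have "\<forall>\<^sub>F x' in at x within \<Omega>. \<Psi> x' \<noteq> {} \<and>
     (\<forall>A\<in>\<Psi> x'. norm (\<sigma> x' - \<sigma> x - A *v (x' - x)) \<le> e * norm (x' - x))"
    using e(1) by (intro assms) simp
  ultimately show "\<forall>\<^sub>F x' in at x within \<Omega>. ?f x' < a"
  proof eventually_elim
    case (elim x')
    have "(SUP A\<in>\<Psi> x'. ereal (norm (\<sigma> x' - \<sigma> x - A *v (x' - x)))) \<le> ereal (e * norm (x' - x))"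
      using elim by (intro SUP_least) simp
    then have "?f x' \<le> ereal (e * norm (x' - x)) / ereal (norm (x' - x))"
      using elim by (intro ereal_divide_right_mono) simp_all
    also have "\<dots> = ereal e" using elim by simp
    finally show ?case using e(2) by (rule le_less_trans)
  qed
qed

lemma scd_semismooth_starE:
  assumes ss: "scd_semismooth_star G w" and e: "\<epsilon> > 0"
  obtains d where "d > 0"
    "\<And>x y ys xs. (x, y) \<in> gph G \<Longrightarrow> norm ((x, y) - w) \<le> d \<Longrightarrow> (ys, xs) \<in> \<Union> (S_star G (x, y)) \<Longrightarrow>
        \<bar>xs \<bullet> (x - fst w) - ys \<bullet> (y - snd w)\<bar> \<le> \<epsilon> * norm ((x, y) - w) * norm (ys, xs)"
proof -
  obtain d where d: "d > 0" and D: "\<forall>x y. (x, y) \<in> gph G \<and> norm ((x, y) - w) \<le> d \<longrightarrow>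
      (\<forall>(ys, xs) \<in> \<Union> (S_star G (x, y)).
        \<bar>xs \<bullet> (x - fst w) - ys \<bullet> (y - snd w)\<bar> \<le> \<epsilon> * norm ((x, y) - w) * norm (ys, xs))"
    using ss[unfolded scd_semismooth_star_def, THEN conjunct2, THEN conjunct2, THEN spec, THEN mp, OF e]
    by (elim exE conjE)
  show thesis
  proof (rule that[OF d])
    fix x y ys xs
    assume "(x, y) \<in> gph G" "norm ((x, y) - w) \<le> d" and u: "(ys, xs) \<in> \<Union> (S_star G (x, y))"
    from bspec[OF D[THEN spec, THEN spec, THEN mp, OF conjI[OF this(1,2)]] u]
    show "\<bar>xs \<bullet> (x - fst w) - ys \<bullet> (y - snd w)\<bar> \<le> \<epsilon> * norm ((x, y) - w) * norm (ys, xs)"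
      by (simp only: prod.case)
  qed
qed

theorem theorem5p9:
  fixes F :: "(real^'n) \<times> (real^'m) \<Rightarrow> (real^'m) set"
    and xbar :: "real^'n" and ybar :: "real^'m"
    and \<Omega> :: "(real^'n) set" and \<sigma> :: "real^'n \<Rightarrow> real^'m"
  assumes "0 \<in> F (xbar, ybar)"
    and "scd_around F ((xbar, ybar), 0)"
    and "scd_reg F xbar ybar 0 < \<infinity>"
    and "xbar \<in> interior \<Omega>"
    and "continuous_on \<Omega> \<sigma>"
    and "\<sigma> xbar = ybar"
    and "\<And>x. x \<in> \<Omega> \<Longrightarrow> 0 \<in> F (x, \<sigma> x)"
  shows "\<exists>U. open U \<and> xbar \<in> U \<and> U \<subseteq> \<Omega> \<and>
           mdom (Psi F \<sigma> U) = U \<and>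
           (\<forall>x\<in>U. scd_reg F x (\<sigma> x) 0 < \<infinity> \<and>
              (scd_semismooth_star F ((x, \<sigma> x), 0) \<longrightarrow> semismooth_wrt \<Omega> \<sigma> (Psi F \<sigma> U) x))"
proof -
  let ?pt = "\<lambda>x. ((x, \<sigma> x), 0) :: ((real^'n) \<times> (real^'m)) \<times> (real^'m)"
  obtain d1 K where d1: "d1 > 0" and K: "K \<ge> 0" and
    unif: "\<And>w zs xs ys. dist w ((xbar, ybar), 0) < d1 \<Longrightarrow> (zs, xs, ys) \<in> \<Union> (S_star F w) \<Longrightarrow>
        norm (zs, xs) \<le> K * norm ys"
    using scd_reg_finite_uniform[OF assms(3)] by blast
  obtain d2 where d2: "d2 > 0"
    and scd: "\<And>w. w \<in> gph F \<Longrightarrow> dist w ((xbar, ybar), 0) \<le> d2 \<Longrightarrow> S_star F w \<noteq> {}"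
    using assms(2) unfolding scd_around_def scd_at_def by metis
  \<comment> \<open>Continuity is relative to \<Omega>; full neighborhood limits are available at
    interior points.\<close>
  have cont: "(?pt \<longlongrightarrow> ?pt x) (nhds x)" if "x \<in> interior \<Omega>" for x
  proof -
    have "isCont ?pt x" by (intro continuous_intros continuous_on_interior[OF assms(5) that])
    then show ?thesis unfolding isCont_def by (rule tendsto_at_iff_tendsto_nhds[THEN iffD1])
  qed
  \<comment> \<open>Within \<open>d1\<close> the uniform bound holds; within \<open>d2\<close> the
    SCD property does.\<close>
  have "\<forall>\<^sub>F x in nhds xbar. dist (?pt x) ((xbar, ybar), 0) < min d1 d2"
    using tendstoD[OF cont[OF assms(4)], of "min d1 d2"] d1 d2 by (simp add: assms(6))
  then obtain S where S: "open S" "xbar \<in> S"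
    and near: "\<And>x. x \<in> S \<Longrightarrow> dist (?pt x) ((xbar, ybar), 0) < min d1 d2"
    unfolding eventually_nhds by blast
  define U where "U = S \<inter> interior \<Omega>"
  have U: "open U" "xbar \<in> U" "U \<subseteq> \<Omega>"
    using S assms(4) interior_subset by (auto simp: U_def)
  have gr: "?pt x \<in> gph F" if "x \<in> U" for x
    using that U(3) assms(7) by (auto simp: gph_def)
  have nonempty: "S_star F (?pt x) \<noteq> {}" if "x \<in> U" for x
    using that near[of x] by (intro scd gr) (auto simp: U_def)
  have bd: "norm (zs, xs) \<le> K * norm ys"
    if "x \<in> U" "L \<in> S_star F (?pt x)" "(zs, xs, ys) \<in> L" for x L zs xs ys
    using that near[of x] by (intro unif[of "?pt x"]) (auto simp: U_def)
  have mat: "(fst (ZX_mat L) *v p, X_mat L *v p, p) \<in> L"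
    if "x \<in> U" "L \<in> S_star F (?pt x)" for x L p
    \<comment> \<open>The bound \<open>bd\<close> with \<open>ys = 0\<close> is the injectivity that
      the matrix representation requires.\<close>
    using bd[OF that] by (intro ZX_mat_mem S_star_in_Zsp[OF that(2)]) (force simp: prod_eq_iff)
  have mat_bd: "norm (fst (ZX_mat L) *v p, X_mat L *v p) \<le> K * norm p"
    if "x \<in> U" "L \<in> S_star F (?pt x)" for x L p
    using bd[OF that mat[OF that]] .
  have dom: "mdom (Psi F \<sigma> U) = U"
    using nonempty by (auto simp: mdom_def Psi_def)
  have Psi_bd: "(\<Union>u\<in>U. Psi F \<sigma> U u) \<subseteq> {A. \<forall>h. norm (A *v h) \<le> K * norm h}"
  proof clarify
    fix u A h assume u: "u \<in> U" "A \<in> Psi F \<sigma> U u"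
    then obtain L where L: "L \<in> S_star F (?pt u)" "A = - transpose (X_mat L)"
      by (auto simp: Psi_def)
    have "norm (X_mat L *v p) \<le> K * norm p" for p
      using mat_bd[OF u(1) L(1), of p] norm_snd_le[of "X_mat L *v p" "fst (ZX_mat L) *v p"] by linarith
    from norm_transpose_mult_le[OF this, of h]
    show "norm (A *v h) \<le> K * norm h"
      using L(2) matrix_vector_mult_diff_rdistrib[of 0 "transpose (X_mat L)" h] by simp
  qed
  have "semismooth_wrt \<Omega> \<sigma> (Psi F \<sigma> U) x"
    if x: "x \<in> U" and ss: "scd_semismooth_star F (?pt x)" for x
    unfolding semismooth_wrt_def
  proof (intro conjI)
    show xi: "x \<in> interior \<Omega>" using x by (simp add: U_def)
    show "x \<in> interior (mdom (Psi F \<sigma> U))" using x U(1) by (simp add: dom interior_open)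
    show "\<exists>V. open V \<and> x \<in> V \<and> bounded (\<Union>u\<in>V. Psi F \<sigma> U u)"
      using U(1) x bounded_subset[OF bounded_matrices Psi_bd] by blast
    show "((\<lambda>x'. (SUP A\<in>Psi F \<sigma> U x'. ereal (norm (\<sigma> x' - \<sigma> x - A *v (x' - x)))) / ereal (norm (x' - x)))
             \<longlongrightarrow> 0) (at x within \<Omega>)"
    proof (rule semismooth_limitI)
      fix e :: real assume e: "e > 0"
      \<comment> \<open>The first term permits the absorption in \<open>residual_estimate\<close>;
        the second brings its final constant below \<open>e\<close>.\<close>
      define e' where "e' = min (1 / (2 * (1 + K))) (e / (2 * (1 + K)\<^sup>2))"
      have e': "e' > 0" "e' * (1 + K) \<le> 1 / 2" "2 * e' * (1 + K)\<^sup>2 \<le> e"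
      proof -
        show "e' > 0" using e K by (simp add: e'_def)
        have "e' \<le> 1 / (2 * (1 + K))" "e' \<le> e / (2 * (1 + K)\<^sup>2)" by (simp_all add: e'_def)
        then show "e' * (1 + K) \<le> 1 / 2" "2 * e' * (1 + K)\<^sup>2 \<le> e"
          using K by (simp_all add: field_simps)
      qed
      obtain d where d: "d > 0" and ineq:
        "\<And>xy z zs xs. (xy, z) \<in> gph F \<Longrightarrow> norm ((xy, z) - ?pt x) \<le> d \<Longrightarrow>
          (zs, xs) \<in> \<Union> (S_star F (xy, z)) \<Longrightarrow>
          \<bar>xs \<bullet> (xy - fst (?pt x)) - zs \<bullet> (z - snd (?pt x))\<bar>
             \<le> e' * norm ((xy, z) - ?pt x) * norm (zs, xs)"
        by (rule scd_semismooth_starE[OF ss e'(1)]) (rule that)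
      have "\<forall>\<^sub>F x' in nhds x. dist (?pt x') (?pt x) < d" by (rule tendstoD[OF cont[OF xi] d])
      moreover have "\<forall>\<^sub>F x' in nhds x. x' \<in> U" using U(1) x by (rule eventually_nhds_in_open)
      ultimately have "\<forall>\<^sub>F x' in nhds x. Psi F \<sigma> U x' \<noteq> {} \<and>
          (\<forall>A\<in>Psi F \<sigma> U x'. norm (\<sigma> x' - \<sigma> x - A *v (x' - x)) \<le> e * norm (x' - x))"
      proof eventually_elim
        case (elim x')
        have "norm (\<sigma> x' - \<sigma> x - A *v (x' - x)) \<le> e * norm (x' - x)" if A: "A \<in> Psi F \<sigma> U x'" for A
        proof -
          obtain L where L: "L \<in> S_star F (?pt x')" "A = - transpose (X_mat L)"
            using A elim(2) by (auto simp: Psi_def)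
          define r where "r = \<sigma> x' - \<sigma> x - (- transpose (X_mat L)) *v (x' - x)"
          have "(fst (ZX_mat L) *v r, X_mat L *v r, r) \<in> \<Union> (S_star F (?pt x'))"
            using mat[OF elim(2) L(1)] L(1) by blast
          \<comment> \<open>Both points have last component 0, so the term with \<open>zs\<close>
            drops out and the pairing of \<open>residual_estimate\<close> remains.\<close>
          from ineq[OF gr[OF elim(2)] _ this]
          have "\<bar>(X_mat L *v r, r) \<bullet> (x' - x, \<sigma> x' - \<sigma> x)\<bar>
              \<le> e' * norm (x' - x, \<sigma> x' - \<sigma> x) * norm (fst (ZX_mat L) *v r, X_mat L *v r, r)"
            using elim(1) by (simp add: dist_norm norm_Pair)
          then have "norm r \<le> 2 * e' * (1 + K)\<^sup>2 * norm (x' - x)"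
            unfolding r_def using K mat_bd[OF elim(2) L(1)] e' by (intro residual_estimate) auto
          also have "\<dots> \<le> e * norm (x' - x)" using e'(3) by (intro mult_right_mono) auto
          finally show ?thesis by (simp add: r_def L(2))
        qed
        then show ?case using elim(2) dom by (auto simp: mdom_def)
      qed
      then show "\<forall>\<^sub>F x' in at x within \<Omega>. Psi F \<sigma> U x' \<noteq> {} \<and>
          (\<forall>A\<in>Psi F \<sigma> U x'. norm (\<sigma> x' - \<sigma> x - A *v (x' - x)) \<le> e * norm (x' - x))"
        by (auto simp: eventually_at_filter elim: eventually_mono)
    qed
  qed
  moreover have "scd_reg F x (\<sigma> x) 0 < \<infinity>" if "x \<in> U" for x
    using scd_reg_le[OF K, of F x "\<sigma> x" 0] bd[OF that] by (force intro: le_less_trans)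
  ultimately show ?thesis using U dom by blast
qed

end
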